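(* If $a,b,c\in\mathbb{N}$ then $$ \operatorname{CT}\, (1 - y_1/y_2)^c(1 - y_2/y_1)^c(1 - y_1/y_3)^b(1 - y_3/y_1)^b(1 - y_2/y_3)^a(1 - y_3/y_2)^a = \frac{(2a)!\,(2b)!\,(2c)!\,(a + b + c)!}{a!\,b!\,c!\,(a + b)!\,(a + c)!\,(b + c)!}. $$
   Context: $\mathbb{N}=\{0,1,2,\ldots\}$. $y_1,y_2,y_3$ are commuting indeterminates and $\operatorname{CT}$ denotes the constant term of a Laurent polynomial in $y_1,y_2,y_3$, i.e. the coefficient of $y_1^0y_2^0y_3^0$. *)

theory Defs
  imports Complex_Main "HOL-Library.Poly_Mapping" "HOL-Library.Product_Plus"
begin

text \<open>
  Laurent polynomials in three commuting indeterminates with rational coefficients, as the group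
  algebra of the exponent lattice: a finitely supported function on exponent triples, with
  convolution as multiplication. Exponents are integers, so negative powers are included.
\<close>

type_synonym laurent3 = "(int \<times> int \<times> int) \<Rightarrow>\<^sub>0 rat"

definition y1 :: laurent3 where "y1 = Poly_Mapping.single (1, 0, 0) 1"
definition y2 :: laurent3 where "y2 = Poly_Mapping.single (0, 1, 0) 1"
definition y3 :: laurent3 where "y3 = Poly_Mapping.single (0, 0, 1) 1"

text \<open>
  The type \<open>laurent3\<close> has no division operation, so \<open>y1 / y2\<close> is written \<open>y1 * y2_inv\<close>, where the
  inverses are justified by the lemma \<open>y_inverses\<close>.
\<close>

definition y1_inv :: laurent3 where "y1_inv = Poly_Mapping.single (-1, 0, 0) 1"
definition y2_inv :: laurent3 where "y2_inv = Poly_Mapping.single (0, -1, 0) 1"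
definition y3_inv :: laurent3 where "y3_inv = Poly_Mapping.single (0, 0, -1) 1"

lemma y_inverses: "y1 * y1_inv = 1" "y2 * y2_inv = 1" "y3 * y3_inv = 1"
  by (simp_all add: y1_def y2_def y3_def y1_inv_def y2_inv_def y3_inv_def mult_single
      flip: single_one zero_prod_def)

definition CT :: "laurent3 \<Rightarrow> rat" where
  "CT p = Poly_Mapping.lookup p (0, 0, 0)"

end

theory Submission
  imports Defs
begin

text \<open>
  Since \<open>(1 - x)\<^sup>n (1 - 1/x)\<^sup>n = \<Sum>\<^sub>k (-1)\<^sup>k (2n choose n+k) x\<^sup>k\<close>, taking \<open>x\<close> to be \<open>y1/y2\<close>,
  \<open>y3/y1\<close> and \<open>y2/y3\<close> in turn makes the constant term the diagonal sum
  \<open>\<Sum>\<^sub>k (-1)\<^sup>k (2a choose a+k) (2b choose b+k) (2c choose c+k)\<close>, which is Dixon's sum. The latter is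
  evaluated by induction on \<open>a\<close>: the difference of the two sides of the recurrence in \<open>a\<close>
  telescopes in \<open>k\<close> (a Wilf-Zeilberger pair).
\<close>

text \<open>Extending \<open>1/k!\<close> by zero to negative integers, as
  \<open>1/Gamma(k+1)\<close> does, lets sums run over any sufficiently large symmetric range, and
  identities hold at every integer without boundary cases.\<close>

definition inv_fact :: "int \<Rightarrow> rat" where
  "inv_fact k = (if k < 0 then 0 else 1 / fact (nat k))"

lemma inv_fact_neg: "k < 0 \<Longrightarrow> inv_fact k = 0"
  by (simp add: inv_fact_def)

lemma inv_fact_of_nat [simp]: "inv_fact (int n) = 1 / fact n"
  by (simp add: inv_fact_def)

lemma inv_fact_rec: "inv_fact k = of_int (k + 1) * inv_fact (k + 1)"
proof (cases "k \<ge> 0")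
  case True
  then obtain n where n: "k = int n"
    using nonneg_int_cases by blast
  then have k1: "k + 1 = int (Suc n)"
    by simp
  show ?thesis
    unfolding k1 unfolding n inv_fact_of_nat by (simp add: field_simps del: of_nat_Suc)
next
  case False
  \<comment> \<open>At \<open>k = -1\<close> the factor \<open>k + 1\<close> vanishes, matching the
    default value 0; below that both sides are zero by default.\<close>
  then have "k = -1 \<or> k + 1 < 0"
    by linarith
  then show ?thesis
    by (auto simp: inv_fact_neg)
qed

lemma sum_telescope_int:
  fixes G :: "int \<Rightarrow> 'a::ab_group_add"
  shows "(\<Sum>k=-int N..int N. G (k + 1) - G k) = G (int N + 1) - G (- int N)"
proof (induction N)
  case (Suc N)
  have "{-int (Suc N)..int (Suc N)} = insert (- int N - 1) (insert (int N + 1) {-int N..int N})"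
    by auto
  then show ?case
    using Suc by (simp add: minus_diff_commute add.commute)
qed simp

text \<open>This is the summand of Dixon's sum divided by \<open>(2a)! (2b)! (2c)!\<close>.\<close>

definition dixon_term :: "nat \<Rightarrow> nat \<Rightarrow> nat \<Rightarrow> int \<Rightarrow> rat" where
  "dixon_term a b c k = (-1) powi k
     * (inv_fact (int a + k) * inv_fact (int a - k))
     * (inv_fact (int b + k) * inv_fact (int b - k))
     * (inv_fact (int c + k) * inv_fact (int c - k))"

lemma dixon_recurrence:
  assumes "c \<le> N"
  shows "of_nat ((a + 1) * (a + 1 + b) * (a + 1 + c)) * (\<Sum>k=-int N..int N. dixon_term (a + 1) b c k)
       = of_nat (a + b + c + 1) * (\<Sum>k=-int N..int N. dixon_term a b c k)"
proof -
  \<comment> \<open>The Wilf-Zeilberger certificate: \<open>G k\<close> equals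
    \<open>-(1/2) (a+1+k) (b+k) (c+k)\<close> times \<open>dixon_term (a + 1) b c k\<close>, with
    the linear factors absorbed into the inverse factorials.\<close>
  define G where "G k = - (1/2) * (-1) powi k
     * (inv_fact (int a + k) * inv_fact (int a + 1 - k))
     * (inv_fact (int b + k - 1) * inv_fact (int b - k))
     * (inv_fact (int c + k - 1) * inv_fact (int c - k))" for k
  have wz: "of_nat ((a + 1) * (a + 1 + b) * (a + 1 + c)) * dixon_term (a + 1) b c k
      - of_nat (a + b + c + 1) * dixon_term a b c k = G (k + 1) - G k" for k
  proof -
    \<comment> \<open>Note that \<open>A\<close> stands for \<open>a + 1\<close>, while
      \<open>B\<close> and \<open>C\<close> are \<open>b\<close> and \<open>c\<close>. Every term
      becomes a polynomial in \<open>K\<close>, \<open>A\<close>, \<open>B\<close>, \<open>C\<close>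
      times the same product of \<open>s\<close> and six inverse factorials.\<close>
    define K A B C where "K = (of_int k :: rat)"
      and "A = (of_nat a + 1 :: rat)" and "B = (of_nat b :: rat)" and "C = (of_nat c :: rat)"
    define s where "s = ((-1) powi k :: rat)"
    define ap am bp bm cp cm where
      "ap = inv_fact (int a + 1 + k)" and "am = inv_fact (int a + 1 - k)" and
      "bp = inv_fact (int b + k)" and "bm = inv_fact (int b - k)" and
      "cp = inv_fact (int c + k)" and "cm = inv_fact (int c - k)"
    have rec:
      "inv_fact (int a + k) = (A + K) * ap" "inv_fact (int a - k) = (A - K) * am"
      "inv_fact (int b + k - 1) = (B + K) * bp" "inv_fact (int b - k - 1) = (B - K) * bm"
      "inv_fact (int c + k - 1) = (C + K) * cp" "inv_fact (int c - k - 1) = (C - K) * cm"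
      using inv_fact_rec[of "int a + k"] inv_fact_rec[of "int a - k"]
        inv_fact_rec[of "int b + k - 1"] inv_fact_rec[of "int b - k - 1"]
        inv_fact_rec[of "int c + k - 1"] inv_fact_rec[of "int c - k - 1"]
      by (simp_all add: K_def A_def B_def C_def ap_def am_def bp_def bm_def cp_def cm_def
          algebra_simps)
    have T: "dixon_term (a + 1) b c k = s * (ap * am) * (bp * bm) * (cp * cm)"
      by (simp add: dixon_term_def s_def ap_def am_def bp_def bm_def cp_def cm_def add_ac)
    have T0: "dixon_term a b c k
        = s * ((A + K) * ap * ((A - K) * am)) * (bp * bm) * (cp * cm)"
      unfolding dixon_term_def rec
      by (simp add: s_def bp_def bm_def cp_def cm_def)
    have G0: "G k = - (1/2) * s * ((A + K) * ap * am) * ((B + K) * bp * bm) * ((C + K) * cp * cm)"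
      unfolding G_def rec
      by (simp add: s_def am_def bm_def cm_def)
    have shift: "int a + (k + 1) = int a + 1 + k" "int a + 1 - (k + 1) = int a - k"
      "int b + (k + 1) - 1 = int b + k" "int b - (k + 1) = int b - k - 1"
      "int c + (k + 1) - 1 = int c + k" "int c - (k + 1) = int c - k - 1"
      by simp_all
    have G1: "G (k + 1)
        = (1/2) * s * (ap * ((A - K) * am)) * (bp * ((B - K) * bm)) * (cp * ((C - K) * cm))"
      unfolding G_def shift rec
      by (simp add: s_def power_int_add ap_def bp_def cp_def)
    have coeffs: "of_nat ((a + 1) * (a + 1 + b) * (a + 1 + c)) = A * (A + B) * (A + C)"
      "of_nat (a + b + c + 1) = A + B + C"
      by (simp_all add: A_def B_def C_def del: mult_Suc mult_Suc_right add: add_ac)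
    \<comment> \<open>Without the common factor this reads \<open>A(A+B)(A+C) - (A+B+C)(A+K)(A-K) =
      ((A-K)(B-K)(C-K) + (A+K)(B+K)(C+K))/2\<close>; both sides equal
      \<open>ABC + (A+B+C)K^2\<close>.\<close>
    show ?thesis
      unfolding T T0 G0 G1 coeffs by (simp add: field_simps)
  qed
  \<comment> \<open>At both ends one of the inverse factorials in \<open>c\<close> has the argument
    \<open>c - N - 1\<close>, which is negative.\<close>
  have "G (int N + 1) = 0" "G (- int N) = 0"
    using assms by (simp_all add: G_def inv_fact_neg)
  then have "(\<Sum>k=-int N..int N. G (k + 1) - G k) = 0"
    by (simp add: sum_telescope_int)
  then show ?thesis
    by (simp add: wz[symmetric] sum_subtractf sum_distrib_left)
qed

theorem dixon_identity:
  assumes "c \<le> N"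
  shows "(\<Sum>k=-int N..int N. dixon_term a b c k)
       = fact (a + b + c) / (fact a * fact b * fact c * fact (a + b) * fact (a + c) * fact (b + c))"
proof (induction a)
  case 0
  \<comment> \<open>One of \<open>k\<close> and \<open>-k\<close> is negative, so
    \<open>inv_fact k * inv_fact (-k)\<close> vanishes.\<close>
  have "dixon_term 0 b c k = 0" if "k \<noteq> 0" for k
    using that by (cases "k < 0") (simp_all add: dixon_term_def inv_fact_neg)
  then have "(\<Sum>k=-int N..int N. dixon_term 0 b c k) = (\<Sum>k\<in>{0}. dixon_term 0 b c k)"
    by (intro sum.mono_neutral_right) auto
  also have "\<dots> = 1 / (fact b * fact b * fact c * fact c)"
    using inv_fact_of_nat[of 0] by (simp add: dixon_term_def)
  finally show ?case
    by simp
next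
  case (Suc a)
  define S where "S = (\<Sum>k=-int N..int N. dixon_term (Suc a) b c k)"
  have "(of_nat (Suc a) * of_nat (Suc (a + b)) * of_nat (Suc (a + c))) * S
      = of_nat (Suc (a + b + c)) * (fact (a + b + c)
        / (fact a * fact b * fact c * fact (a + b) * fact (a + c) * fact (b + c)))"
    using dixon_recurrence[OF assms, of a b]
    by (simp only: Suc S_def Suc_eq_plus1 of_nat_mult add_ac)
  then have "S = of_nat (Suc (a + b + c)) * (fact (a + b + c)
        / (fact a * fact b * fact c * fact (a + b) * fact (a + c) * fact (b + c)))
        / (of_nat (Suc a) * of_nat (Suc (a + b)) * of_nat (Suc (a + c)))"
    by (simp add: eq_divide_eq mult.commute del: of_nat_Suc)
  then show ?case
    unfolding S_def by (simp del: of_nat_Suc)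
qed

text \<open>The signed binomial coefficient \<open>(-1)^k (2n choose n+k)\<close>, written with
  \<open>inv_fact\<close> so that it is zero for \<open>|k| > n\<close> and matches the factors of
  \<open>dixon_term\<close>.\<close>

definition laurent_coeff :: "nat \<Rightarrow> int \<Rightarrow> rat" where
  "laurent_coeff n k = fact (2 * n) * ((-1) powi k * (inv_fact (int n + k) * inv_fact (int n - k)))"

lemma laurent_coeff_eq_binomial:
  assumes "j \<le> 2 * n"
  shows "laurent_coeff n (int j - int n) = (-1) ^ (n + j) * of_nat (2 * n choose j)"
proof -
  have "int n - (int j - int n) = int (2 * n - j)" "int n + (int j - int n) = int j"
    using assms by simp_all
  moreover have "(-1 :: rat) powi (int j - int n) = (-1) ^ (n + j)"
    by (simp add: power_int_diff power_add field_simps)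
  ultimately show ?thesis
    using assms by (simp only: laurent_coeff_def inv_fact_of_nat) (simp add: binomial_fact)
qed

lemma laurent_coeff_eq_0: "\<bar>k\<bar> > int n \<Longrightarrow> laurent_coeff n k = 0"
  by (cases "k > int n") (auto simp: laurent_coeff_def inv_fact_neg)

text \<open>Additivity of \<open>e\<close> makes \<open>single (e k) 1\<close> the
  \<open>k\<close>-th power of one monomial, so a single proof serves all three pairs of factors.
  Padding with zero coefficients up to \<open>N\<close> gives them a common range.\<close>

lemma one_minus_monomial_power_mult:
  fixes e :: "int \<Rightarrow> 'a::ab_group_add"
  assumes e: "\<And>i j. e (i + j) = e i + e j" and "n \<le> N"
  shows "(1 - Poly_Mapping.single (e 1) (1 :: rat)) ^ n * (1 - Poly_Mapping.single (e (-1)) 1) ^ n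
       = (\<Sum>k=-int N..int N. Poly_Mapping.single (e k) (laurent_coeff n k))"
proof -
  define X where "X k = Poly_Mapping.single (e k) (1 :: rat)" for k
  have e0: "e 0 = 0"
    using e[of 0 0] by simp
  have X_add: "X i * X j = X (i + j)" for i j
    by (simp add: X_def mult_single e)
  have X_0: "X 0 = 1"
    by (simp add: X_def e0)
  have X_pow: "X i ^ m = X (int m * i)" for i m
    by (induction m) (simp_all add: X_0 X_add algebra_simps)
  \<comment> \<open>The binomial theorem yields integer constants as ring elements; here they become
    scalar coefficients of a monomial.\<close>
  have const: "((-1) ^ m * of_nat l) * X k = Poly_Mapping.single (e k) ((-1) ^ m * of_nat l)"
    for m l k
  proof -
    have "(-1) ^ m * of_nat l = (of_int ((-1) ^ m * int l) :: 'a \<Rightarrow>\<^sub>0 rat)"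
      by simp
    also have "\<dots> = Poly_Mapping.single 0 (of_int ((-1) ^ m * int l))"
      by (rule single_of_int[symmetric])
    finally show ?thesis
      by (simp add: X_def mult_single)
  qed
  \<comment> \<open>The identity \<open>1 - 1/x = (-1/x)(1 - x)\<close> reduces the product to a
    shifted binomial expansion of \<open>(1 - x)^(2n)\<close>.\<close>
  have inv: "1 - X (-1) = (- 1 * X (-1)) * (1 - X 1)"
    by (simp add: algebra_simps X_add X_0)
  have "(1 - X 1) ^ n * (1 - X (-1)) ^ n = (- 1 * X (-1)) ^ n * (1 - X 1) ^ (2 * n)"
    unfolding inv mult_2 by (simp only: power_mult_distrib power_add mult_ac)
  also have "(1 - X 1) ^ (2 * n) = (\<Sum>j\<le>2 * n. of_nat (2 * n choose j) * ((-1) ^ j * X (int j)))"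
    using binomial_ring[of "- 1 * X 1" 1 "2 * n"]
    by (simp add: power_minus[of "X 1"] X_pow)
  also have "(- 1 * X (-1)) ^ n * \<dots>
      = (\<Sum>j\<le>2 * n. ((-1) ^ (n + j) * of_nat (2 * n choose j)) * (X (- int n) * X (int j)))"
    unfolding power_mult_distrib X_pow by (simp add: sum_distrib_left power_add mult_ac)
  also have "\<dots> = (\<Sum>j\<le>2 * n. Poly_Mapping.single (e (int j - int n)) (laurent_coeff n (int j - int n)))"
    unfolding X_add const by (intro sum.cong) (simp_all add: laurent_coeff_eq_binomial)
  also have "\<dots> = (\<Sum>k=-int n..int n. Poly_Mapping.single (e k) (laurent_coeff n k))"
    by (rule sum.reindex_bij_witness[of _ "\<lambda>k. nat (k + int n)" "\<lambda>j. int j - int n"]) auto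
  also have "\<dots> = (\<Sum>k=-int N..int N. Poly_Mapping.single (e k) (laurent_coeff n k))"
    using \<open>n \<le> N\<close> by (intro sum.mono_neutral_left) (auto simp: laurent_coeff_eq_0)
  finally show ?thesis
    by (simp add: X_def)
qed

theorem theorem3p1:
  fixes a b c :: nat
  shows "CT ((1 - y1 * y2_inv) ^ c * (1 - y2 * y1_inv) ^ c
           * (1 - y1 * y3_inv) ^ b * (1 - y3 * y1_inv) ^ b
           * (1 - y2 * y3_inv) ^ a * (1 - y3 * y2_inv) ^ a)
         = (fact (2 * a) * fact (2 * b) * fact (2 * c) * fact (a + b + c))
           / (fact a * fact b * fact c * fact (a + b) * fact (a + c) * fact (b + c))"
proof -
  define N where "N = a + b + c"
  define K where "K = {-int N..int N}"
  have fin: "finite K"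
    by (simp add: K_def)
  have c: "(1 - y1 * y2_inv) ^ c * (1 - y2 * y1_inv) ^ c
      = (\<Sum>p\<in>K. Poly_Mapping.single (p, - p, 0) (laurent_coeff c p))"
    using one_minus_monomial_power_mult[of "\<lambda>k. (k, - k, 0)" c N]
    by (simp add: K_def N_def y1_def y2_def y1_inv_def y2_inv_def mult_single)
  \<comment> \<open>The direction is reversed, with \<open>y3/y1\<close> as base monomial, because
    \<open>(y1/y2)(y2/y3)(y3/y1) = 1\<close>: equal exponents then cancel.\<close>
  have b: "(1 - y1 * y3_inv) ^ b * (1 - y3 * y1_inv) ^ b
      = (\<Sum>q\<in>K. Poly_Mapping.single (- q, 0, q) (laurent_coeff b q))"
    using one_minus_monomial_power_mult[of "\<lambda>k. (- k, 0, k)" b N]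
    by (simp add: K_def N_def y1_def y3_def y1_inv_def y3_inv_def mult_single mult.commute)
  have a: "(1 - y2 * y3_inv) ^ a * (1 - y3 * y2_inv) ^ a
      = (\<Sum>r\<in>K. Poly_Mapping.single (0, r, - r) (laurent_coeff a r))"
    using one_minus_monomial_power_mult[of "\<lambda>k. (0, k, - k)" a N]
    by (simp add: K_def N_def y2_def y3_def y2_inv_def y3_inv_def mult_single)
  let ?w = "\<lambda>p q r. laurent_coeff c p * laurent_coeff b q * laurent_coeff a r"
  have "CT ((1 - y1 * y2_inv) ^ c * (1 - y2 * y1_inv) ^ c
           * (1 - y1 * y3_inv) ^ b * (1 - y3 * y1_inv) ^ b
           * (1 - y2 * y3_inv) ^ a * (1 - y3 * y2_inv) ^ a)
      = CT ((\<Sum>p\<in>K. Poly_Mapping.single (p, - p, 0) (laurent_coeff c p))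
          * (\<Sum>q\<in>K. Poly_Mapping.single (- q, 0, q) (laurent_coeff b q))
          * (\<Sum>r\<in>K. Poly_Mapping.single (0, r, - r) (laurent_coeff a r)))"
    by (simp only: a[symmetric] b[symmetric] c[symmetric] mult.assoc)
  also have "(\<Sum>p\<in>K. Poly_Mapping.single (p, - p, 0) (laurent_coeff c p))
          * (\<Sum>q\<in>K. Poly_Mapping.single (- q, 0, q) (laurent_coeff b q))
      = (\<Sum>p\<in>K. \<Sum>q\<in>K. Poly_Mapping.single (p - q, - p, q) (laurent_coeff c p * laurent_coeff b q))"
    by (simp add: sum_product mult_single)
  also have "CT (\<dots> * (\<Sum>r\<in>K. Poly_Mapping.single (0, r, - r) (laurent_coeff a r)))
      = CT (\<Sum>p\<in>K. \<Sum>q\<in>K. \<Sum>r\<in>K. Poly_Mapping.single (p - q, r - p, q - r) (?w p q r))"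
    unfolding sum_distrib_right unfolding sum_distrib_left by (simp add: mult_single)
  \<comment> \<open>The exponent \<open>(p - q, r - p, q - r)\<close> is zero exactly when
    \<open>p = q = r\<close>. Nesting the conditions lets the sums over \<open>r\<close> and then
    \<open>q\<close> collapse.\<close>
  also have "\<dots> = (\<Sum>p\<in>K. \<Sum>q\<in>K. \<Sum>r\<in>K. if r = p then (if q = p then ?w p q r else 0) else 0)"
    unfolding CT_def lookup_sum lookup_single by (intro sum.cong refl) (auto simp: when_def)
  also have "\<dots> = (\<Sum>p\<in>K. ?w p p p)"
    using fin by (simp add: sum.delta sum.delta')
  also have "\<dots> = (\<Sum>k\<in>K. fact (2 * a) * fact (2 * b) * fact (2 * c) * dixon_term a b c k)"
  proof (intro sum.cong refl)
    fix k :: int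
    \<comment> \<open>The three coefficients contribute three signs; two cancel, leaving the single
      sign in \<open>dixon_term\<close>.\<close>
    have "(-1 :: rat) powi k * (-1) powi k = 1"
      by (simp flip: power_int_mult_distrib)
    then show "?w k k k = fact (2 * a) * fact (2 * b) * fact (2 * c) * dixon_term a b c k"
      unfolding laurent_coeff_def dixon_term_def by algebra
  qed
  also have "\<dots> = fact (2 * a) * fact (2 * b) * fact (2 * c) * (\<Sum>k\<in>K. dixon_term a b c k)"
    by (simp add: sum_distrib_left)
  also have "(\<Sum>k\<in>K. dixon_term a b c k) = fact (a + b + c)
      / (fact a * fact b * fact c * fact (a + b) * fact (a + c) * fact (b + c))"
    unfolding K_def by (rule dixon_identity) (simp add: N_def)
  finally show ?thesis
    by simp
qed

end
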